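(* Let $d\ge 0$ be an integer, let $\Gamma$ be a group that is generated by the union of finitely many subsets $A_1,\dots,A_m\subseteq\Gamma$, and let $X$ be a complete $\mathrm{CAT}(0)$ space of dimension at most $d$ on which $\Gamma$ acts by isometries. If for every choice of at most $d+1$ of the sets $A_i$ the subgroup generated by their union has a fixed point in $X$, then $\Gamma$ has a fixed point in $X$.
   Context: $\mathrm{CAT}(0)$ spaces are non-empty and not assumed locally compact. An action by isometries is a homomorphism $\Gamma\to\mathrm{Isom}(X)$. A subgroup $H$ has a fixed point if there is $x\in X$ with $hx=x$ for all $h\in H$. Dimension means topological covering dimension: $\dim(X)\le d$ if for every closed subspace $K\subseteq X$ and every $r\ge d$, every continuous map $K\to\mathbb{S}^r$ to the $r$-sphere extends to a continuous map $X\to\mathbb{S}^r$. *)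

theory Defs
  imports "HOL-Analysis.Analysis" "HOL-Algebra.Group_Action" "HOL-Algebra.Generated_Groups"
begin

section \<open>CAT(0) spaces\<close>

definition geodesic_path ::
    "'a set \<Rightarrow> ('a \<Rightarrow> 'a \<Rightarrow> real) \<Rightarrow> 'a \<Rightarrow> 'a \<Rightarrow> (real \<Rightarrow> 'a) \<Rightarrow> bool" where
  "geodesic_path X \<rho> x y c \<longleftrightarrow>
     c \<in> {0..\<rho> x y} \<rightarrow> X \<and> c 0 = x \<and> c (\<rho> x y) = y \<and>
     (\<forall>s\<in>{0..\<rho> x y}. \<forall>t\<in>{0..\<rho> x y}. \<rho> (c s) (c t) = \<bar>s - t\<bar>)"

definition geodesic_segment ::
    "'a set \<Rightarrow> ('a \<Rightarrow> 'a \<Rightarrow> real) \<Rightarrow> 'a \<Rightarrow> 'a \<Rightarrow> 'a set \<Rightarrow> bool" where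
  "geodesic_segment X \<rho> x y S \<longleftrightarrow> (\<exists>c. geodesic_path X \<rho> x y c \<and> S = c ` {0..\<rho> x y})"

text \<open>The point \<open>x'\<close> of the Euclidean segment from \<open>p'\<close> to \<open>q'\<close> corresponds to the
  point \<open>x\<close> of the geodesic segment \<open>S\<close> from \<open>p\<close> to \<open>q\<close>.\<close>

definition comparison_point ::
    "('a \<Rightarrow> 'a \<Rightarrow> real) \<Rightarrow> 'a \<Rightarrow> 'a set \<Rightarrow> real^2 \<Rightarrow> real^2 \<Rightarrow> 'a \<Rightarrow> real^2 \<Rightarrow> bool" where
  "comparison_point \<rho> p S p' q' x x' \<longleftrightarrow>
     x \<in> S \<and> x' \<in> closed_segment p' q' \<and> dist p' x' = \<rho> p x"

text \<open>A geodesic triangle has vertices \<open>p\<close>, \<open>q\<close>, \<open>r\<close> and chosen sides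
  \<open>A = [p,q]\<close>, \<open>B = [q,r]\<close>, \<open>C = [r,p]\<close>; a comparison triangle has
  vertices \<open>p'\<close>, \<open>q'\<close>, \<open>r'\<close>.  The inequality is required for all
  pairs of points of the triangle.\<close>

locale CAT0_space = Metric_space X \<rho>
  for X :: "'a set" and \<rho> :: "'a \<Rightarrow> 'a \<Rightarrow> real" +
  assumes nonempty: "X \<noteq> {}"
    and geodesic: "\<And>x y. \<lbrakk>x \<in> X; y \<in> X\<rbrakk> \<Longrightarrow> \<exists>c. geodesic_path X \<rho> x y c"
    and CAT0_inequality:
      "\<And>p q r A B C (p' :: real^2) q' r' x x' y y'.
        \<lbrakk>p \<in> X; q \<in> X; r \<in> X;
         geodesic_segment X \<rho> p q A; geodesic_segment X \<rho> q r B; geodesic_segment X \<rho> r p C;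
         dist p' q' = \<rho> p q; dist q' r' = \<rho> q r; dist r' p' = \<rho> r p;
         comparison_point \<rho> p A p' q' x x' \<or> comparison_point \<rho> q B q' r' x x' \<or>
           comparison_point \<rho> r C r' p' x x';
         comparison_point \<rho> p A p' q' y y' \<or> comparison_point \<rho> q B q' r' y y' \<or>
           comparison_point \<rho> r C r' p' y y'\<rbrakk>
        \<Longrightarrow> \<rho> x y \<le> dist x' y'"


section \<open>Covering dimension\<close>

text \<open>Covering dimension at most \<open>d\<close>, in terms of extending maps to spheres.
  \<open>nsphere r\<close> is the unit sphere of dimension \<open>r\<close>, sitting in a Euclidean
  space of dimension \<open>r + 1\<close>.\<close>

definition covering_dim_le :: "'a topology \<Rightarrow> nat \<Rightarrow> bool" where
  "covering_dim_le T d \<longleftrightarrow>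
     (\<forall>K r f. closedin T K \<and> d \<le> r \<and> continuous_map (subtopology T K) (nsphere r) f \<longrightarrow>
        (\<exists>g. continuous_map T (nsphere r) g \<and> (\<forall>x\<in>K. g x = f x)))"


section \<open>Actions by isometries\<close>

definition isometry_group :: "'a set \<Rightarrow> ('a \<Rightarrow> 'a \<Rightarrow> real) \<Rightarrow> ('a \<Rightarrow> 'a) monoid" where
  "isometry_group X \<rho> =
     (BijGroup X)\<lparr>carrier := {f \<in> Bij X. \<forall>x\<in>X. \<forall>y\<in>X. \<rho> (f x) (f y) = \<rho> x y}\<rparr>"

lemma group_isometry_group: "group (isometry_group X \<rho>)"
proof -
  interpret B: group "BijGroup X" by (rule group_BijGroup)
  have "subgroup {f \<in> Bij X. \<forall>x\<in>X. \<forall>y\<in>X. \<rho> (f x) (f y) = \<rho> x y} (BijGroup X)"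
  proof (rule B.subgroupI)
    show "{f \<in> Bij X. \<forall>x\<in>X. \<forall>y\<in>X. \<rho> (f x) (f y) = \<rho> x y} \<subseteq> carrier (BijGroup X)"
      by (auto simp: BijGroup_def)
    have "(\<lambda>x\<in>X. x) \<in> {f \<in> Bij X. \<forall>x\<in>X. \<forall>y\<in>X. \<rho> (f x) (f y) = \<rho> x y}"
      by (simp add: id_Bij)
    then show "{f \<in> Bij X. \<forall>x\<in>X. \<forall>y\<in>X. \<rho> (f x) (f y) = \<rho> x y} \<noteq> {}" by blast
  next
    fix f assume "f \<in> {f \<in> Bij X. \<forall>x\<in>X. \<forall>y\<in>X. \<rho> (f x) (f y) = \<rho> x y}"
    then have f: "f \<in> Bij X" "\<And>x y. x \<in> X \<Longrightarrow> y \<in> X \<Longrightarrow> \<rho> (f x) (f y) = \<rho> x y" by auto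
    then have im: "f ` X = X" by (simp add: Bij_def bij_betw_def)
    have "\<rho> (inv_into X f x) (inv_into X f y) = \<rho> x y" if "x \<in> X" "y \<in> X" for x y
      using f(2)[of "inv_into X f x" "inv_into X f y"] that im
      by (simp add: f_inv_into_f inv_into_into)
    then show "inv\<^bsub>BijGroup X\<^esub> f \<in> {f \<in> Bij X. \<forall>x\<in>X. \<forall>y\<in>X. \<rho> (f x) (f y) = \<rho> x y}"
      using f(1) by (simp add: inv_BijGroup restrict_inv_into_Bij)
  next
    fix f g
    assume "f \<in> {f \<in> Bij X. \<forall>x\<in>X. \<forall>y\<in>X. \<rho> (f x) (f y) = \<rho> x y}"
      and "g \<in> {f \<in> Bij X. \<forall>x\<in>X. \<forall>y\<in>X. \<rho> (f x) (f y) = \<rho> x y}"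
    moreover from this have "\<And>x. x \<in> X \<Longrightarrow> g x \<in> X" using Bij_imp_funcset by blast
    ultimately show "f \<otimes>\<^bsub>BijGroup X\<^esub> g \<in> {f \<in> Bij X. \<forall>x\<in>X. \<forall>y\<in>X. \<rho> (f x) (f y) = \<rho> x y}"
      by (auto simp: BijGroup_def compose_Bij compose_eq)
  qed
  then show ?thesis
    unfolding isometry_group_def by (rule B.subgroup_imp_group)
qed

definition has_fixed_point :: "'a set \<Rightarrow> ('g \<Rightarrow> 'a \<Rightarrow> 'a) \<Rightarrow> 'g set \<Rightarrow> bool" where
  "has_fixed_point X \<phi> H \<longleftrightarrow> (\<exists>x\<in>X. \<forall>h\<in>H. \<phi> h x = x)"

end

theory Submission
  imports Defs "HOL-Homology.Brouwer_Degree"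
begin

text \<open>
  The fixed-point set of each \<open>A i\<close> is closed and geodesically convex, because geodesics in a
  CAT(0) space are unique and hence an isometry fixing two points fixes the geodesic between them.
  A point is fixed by the subgroup generated by a union of the \<open>A i\<close> exactly when it lies in all of
  the corresponding fixed-point sets.  The result is therefore Helly's theorem (\<open>helly\<close>) for finitely
  many closed convex sets in a CAT(0) space of covering dimension at most \<open>d\<close>.

  Helly's theorem follows by induction from the case of \<open>r + 2\<close> sets \<open>C 0, \<dots>, C (r + 1)\<close> with
  \<open>d \<le> r\<close>, any \<open>r + 1\<close> of which have a common point (\<open>helly_step\<close>).  Suppose that all of them
  together have none.  Then the distances \<open>\<phi> i\<close> to the sets have no common zero, and on the closed
  set \<open>K\<close> where at least one of them vanishes they are not all equal, so the differences
  \<open>\<phi> i - \<phi> (r + 1)\<close> normalise to a continuous map from \<open>K\<close> to the \<open>r\<close>-sphere.  The bound on the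
  dimension extends it to a map \<open>g\<close> on the whole space.

  In the other direction, pick \<open>p i\<close> in the intersection of all sets but \<open>C i\<close>.  Coning off along
  geodesics turns weights on the \<open>p i\<close> into points of the space (\<open>iterated_cone\<close>), and a point built
  from weights with \<open>i\<close>-th weight zero lies in \<open>C i\<close>.  Composing with weights on the sphere that
  measure how far a coordinate lies above the smallest one (\<open>spread_weights\<close>) gives a map \<open>h\<close> from
  the \<open>r\<close>-sphere into \<open>K\<close>.  The map \<open>g \<circ> h\<close> from the sphere to itself never sends a point to its
  antipode: \<open>\<phi> i\<close> vanishes where the coordinate \<open>v i\<close> is smallest, whereas an antipodal value would
  make \<open>\<phi> i\<close> largest exactly there, forcing all the distances to vanish.  So \<open>g \<circ> h\<close> is
  homotopic to the identity.  But raising all weights to \<open>1\<close> contracts \<open>h\<close> to a constant inside the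
  space, so \<open>g \<circ> h\<close> is nullhomotopic, and the sphere would be contractible.
\<close>


section \<open>Geodesics in CAT(0) spaces\<close>

lemma comparison_triangle_exists:
  fixes a b c :: real
  assumes "0 \<le> a" "0 \<le> b" "c \<le> a + b" "a \<le> b + c" "b \<le> a + c"
  obtains q r :: "real^2" where "norm q = a" "norm r = b" "dist q r = c"
proof (cases "a = 0")
  case True
  with assms have "c = b" by simp
  have "norm (b *\<^sub>R axis 1 1 :: real^2) = b"
    using assms by (simp add: norm_axis_1)
  then show ?thesis
    using that[of 0 "b *\<^sub>R axis 1 1"] True \<open>c = b\<close> by simp
next
  case False
  with assms have a: "a > 0" and c: "c \<ge> 0" by auto
  \<comment> \<open>Put \<open>q\<close> at \<open>(a, 0)\<close>; by the law of cosines the first coordinate of \<open>r\<close> must then be \<open>u\<close>.\<close>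
  define u where "u = (a\<^sup>2 + b\<^sup>2 - c\<^sup>2) / (2 * a)"
  have 1: "2 * a * u = a\<^sup>2 + b\<^sup>2 - c\<^sup>2"
    using a by (simp add: u_def)
  have "(2 * a * u)\<^sup>2 \<le> (2 * a * b)\<^sup>2"
  proof -
    have "(2 * a * b)\<^sup>2 - (2 * a * u)\<^sup>2 = ((a + b)\<^sup>2 - c\<^sup>2) * (c\<^sup>2 - (a - b)\<^sup>2)"
      unfolding 1 by (simp add: power2_eq_square algebra_simps)
    moreover have "c\<^sup>2 \<le> (a + b)\<^sup>2" "(a - b)\<^sup>2 \<le> c\<^sup>2"
      using assms c by (auto intro: power_mono simp: abs_le_square_iff[symmetric])
    ultimately show ?thesis
      by (smt (verit) mult_nonneg_nonneg)
  qed
  then have "u\<^sup>2 \<le> b\<^sup>2"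
    using a by (simp add: power_mult_distrib)
  define q r :: "real^2" where "q = vector [a, 0]" and "r = vector [u, sqrt (b\<^sup>2 - u\<^sup>2)]"
  show ?thesis
  proof
    show "norm q = a"
      using a by (simp add: q_def norm_vec_def L2_set_def sum_2)
    show "norm r = b"
      using \<open>u\<^sup>2 \<le> b\<^sup>2\<close> assms by (simp add: r_def norm_vec_def L2_set_def sum_2)
    have "(a - u)\<^sup>2 + (b\<^sup>2 - u\<^sup>2) = c\<^sup>2"
      using 1 by (simp add: power2_eq_square algebra_simps)
    then show "dist q r = c"
      using \<open>u\<^sup>2 \<le> b\<^sup>2\<close> c by (simp add: q_def r_def dist_norm norm_vec_def L2_set_def sum_2)
  qed
qed

context CAT0_space
begin

lemma geodesic_path_reverse:
  assumes "geodesic_path X \<rho> x y c"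
  shows "geodesic_path X \<rho> y x (\<lambda>s. c (\<rho> x y - s))"
proof -
  have "\<rho> (c s) (c t) = \<bar>s - t\<bar>" if "s \<in> {0..\<rho> x y}" "t \<in> {0..\<rho> x y}" for s t
    using assms that by (simp add: geodesic_path_def)
  from this[of "\<rho> x y - _" "\<rho> x y - _"] show ?thesis
    using assms by (auto simp: geodesic_path_def commute[of y x] Pi_iff)
qed

lemma geodesic_segment_reverse:
  assumes "geodesic_path X \<rho> x y c"
  shows "geodesic_segment X \<rho> y x (c ` {0..\<rho> x y})"
proof -
  have "c ` {0..\<rho> x y} = (\<lambda>s. c (\<rho> x y - s)) ` {0..\<rho> y x}"
    by (simp add: image_image[of c "\<lambda>s. \<rho> x y - s", symmetric] commute[of y x])
  then show ?thesis
    using geodesic_path_reverse[OF assms] by (auto simp: geodesic_segment_def)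
qed

lemma geodesic_path_point:
  assumes "geodesic_path X \<rho> x y c" "0 \<le> s" "s \<le> \<rho> x y"
  shows "c s \<in> X" "\<rho> x (c s) = s" "\<rho> (c s) y = \<rho> x y - s"
proof -
  have c: "c 0 = x" "c (\<rho> x y) = y" "c \<in> {0..\<rho> x y} \<rightarrow> X"
    and "\<forall>s\<in>{0..\<rho> x y}. \<forall>t\<in>{0..\<rho> x y}. \<rho> (c s) (c t) = \<bar>s - t\<bar>"
    using assms(1) by (simp_all add: geodesic_path_def)
  then have "\<rho> (c 0) (c s) = \<bar>0 - s\<bar>" "\<rho> (c s) (c (\<rho> x y)) = \<bar>s - \<rho> x y\<bar>"
    using assms(2,3) by (meson atLeastAtMost_iff nonneg order_refl)+
  then show "\<rho> x (c s) = s" "\<rho> (c s) y = \<rho> x y - s"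
    using assms(2,3) unfolding c by auto
  show "c s \<in> X"
    using c(3) assms(2,3) by auto
qed

text \<open>In the Euclidean comparison triangle with the vertex for \<open>p\<close> at the origin, the two points
  correspond to \<open>t *\<^sub>R q\<close> and \<open>t *\<^sub>R r\<close>, whose distance is \<open>t * dist q r\<close>.\<close>

lemma geodesics_from_point_contract:
  assumes "p \<in> X" "x \<in> X" "y \<in> X" and c: "geodesic_path X \<rho> p x c"
    and c': "geodesic_path X \<rho> p y c'" and t: "0 \<le> t" "t \<le> 1"
  shows "\<rho> (c (t * \<rho> p x)) (c' (t * \<rho> p y)) \<le> t * \<rho> x y"
proof -
  obtain q r :: "real^2" where q: "norm q = \<rho> p x" and r: "norm r = \<rho> p y" and qr: "dist q r = \<rho> x y"
    using comparison_triangle_exists[of "\<rho> p x" "\<rho> p y" "\<rho> x y"] assms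
      triangle[of p x y] triangle[of x p y] triangle[of p y x]
    by (metis (no_types, opaque_lifting) commute nonneg add.commute)
  obtain b where b: "geodesic_path X \<rho> x y b"
    using geodesic assms by blast
  have I: "t * \<rho> p x \<in> {0..\<rho> p x}" "t * \<rho> p y \<in> {0..\<rho> p y}"
    using t by (auto simp: mult_left_le_one_le)
  have d1: "\<rho> p (c (t * \<rho> p x)) = t * \<rho> p x"
    using geodesic_path_point(2)[OF c] I by simp
  have d2: "\<rho> y (c' (t * \<rho> p y)) = (1 - t) * \<rho> p y"
    using geodesic_path_point(3)[OF c', of "t * \<rho> p y"] I
    by (simp add: commute[of y] left_diff_distrib)
  have "\<rho> (c (t * \<rho> p x)) (c' (t * \<rho> p y)) \<le> dist (t *\<^sub>R q) (t *\<^sub>R r)"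
  proof (rule CAT0_inequality[of p x y "c ` {0..\<rho> p x}" "b ` {0..\<rho> x y}" "c' ` {0..\<rho> p y}" 0 q r])
    show "geodesic_segment X \<rho> p x (c ` {0..\<rho> p x})" "geodesic_segment X \<rho> x y (b ` {0..\<rho> x y})"
      using b c by (auto simp: geodesic_segment_def)
    show "geodesic_segment X \<rho> y p (c' ` {0..\<rho> p y})"
      using geodesic_segment_reverse[OF c'] .
    have "t *\<^sub>R q \<in> closed_segment 0 q"
      using t by (auto simp: in_segment)
    then show "comparison_point \<rho> p (c ` {0..\<rho> p x}) 0 q (c (t * \<rho> p x)) (t *\<^sub>R q) \<or>
      comparison_point \<rho> x (b ` {0..\<rho> x y}) q r (c (t * \<rho> p x)) (t *\<^sub>R q) \<or>
      comparison_point \<rho> y (c' ` {0..\<rho> p y}) r 0 (c (t * \<rho> p x)) (t *\<^sub>R q)"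
      using I t d1 q by (simp add: comparison_point_def)
    have "t *\<^sub>R r \<in> closed_segment r 0"
      using t by (subst closed_segment_commute) (auto simp: in_segment)
    moreover have "dist r (t *\<^sub>R r) = (1 - t) * \<rho> p y"
    proof -
      have "r - t *\<^sub>R r = (1 - t) *\<^sub>R r" by (simp add: algebra_simps)
      then show ?thesis using t r by (simp add: dist_norm)
    qed
    ultimately show "comparison_point \<rho> p (c ` {0..\<rho> p x}) 0 q (c' (t * \<rho> p y)) (t *\<^sub>R r) \<or>
      comparison_point \<rho> x (b ` {0..\<rho> x y}) q r (c' (t * \<rho> p y)) (t *\<^sub>R r) \<or>
      comparison_point \<rho> y (c' ` {0..\<rho> p y}) r 0 (c' (t * \<rho> p y)) (t *\<^sub>R r)"
      using I d2 by (simp add: comparison_point_def)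
  qed (use assms q r qr commute in auto)
  also have "\<dots> = t * \<rho> x y"
    using t qr by (simp add: dist_norm flip: scaleR_diff_right)
  finally show ?thesis .
qed

text \<open>The triangle \<open>p\<close>, \<open>x\<close>, \<open>z\<close> has a degenerate comparison triangle, lying on the line
  spanned by \<open>e\<close>, in which \<open>c s\<close> and \<open>z\<close> have the same comparison point.\<close>

lemma geodesic_point_unique:
  assumes "p \<in> X" "x \<in> X" "z \<in> X" and c: "geodesic_path X \<rho> p x c"
    and s: "0 \<le> s" "s \<le> \<rho> p x" and z: "\<rho> p z = s" "\<rho> z x = \<rho> p x - s"
  shows "c s = z"
proof -
  obtain b where b: "geodesic_path X \<rho> x z b"
    using geodesic assms by blast
  obtain a where a: "geodesic_path X \<rho> z p a"
    using geodesic assms by blast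
  define e where "e = (axis 1 1 :: real^2)"
  have e: "norm e = 1" by (simp add: e_def norm_axis_1)
  have ds: "dist (u *\<^sub>R e) (v *\<^sub>R e) = \<bar>u - v\<bar>" for u v
    using e by (simp add: dist_norm flip: scaleR_diff_left)
  have cs: "c s \<in> X" "\<rho> p (c s) = s"
    using geodesic_path_point[OF c s] by auto
  have "\<rho> (c s) z \<le> dist (s *\<^sub>R e) (s *\<^sub>R e)"
  proof (rule CAT0_inequality[of p x z "c ` {0..\<rho> p x}" "b ` {0..\<rho> x z}" "a ` {0..\<rho> z p}"
        "0 *\<^sub>R e" "\<rho> p x *\<^sub>R e" "s *\<^sub>R e"])
    show "comparison_point \<rho> p (c ` {0..\<rho> p x}) (0 *\<^sub>R e) (\<rho> p x *\<^sub>R e) (c s) (s *\<^sub>R e) \<or>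
      comparison_point \<rho> x (b ` {0..\<rho> x z}) (\<rho> p x *\<^sub>R e) (s *\<^sub>R e) (c s) (s *\<^sub>R e) \<or>
      comparison_point \<rho> z (a ` {0..\<rho> z p}) (s *\<^sub>R e) (0 *\<^sub>R e) (c s) (s *\<^sub>R e)"
    proof -
      have "s *\<^sub>R e \<in> closed_segment (0 *\<^sub>R e) (\<rho> p x *\<^sub>R e)"
      proof (cases "\<rho> p x = 0")
        case True
        with s show ?thesis by simp
      next
        case False
        then have "s *\<^sub>R e = (1 - s / \<rho> p x) *\<^sub>R 0 *\<^sub>R e + (s / \<rho> p x) *\<^sub>R \<rho> p x *\<^sub>R e"
          by simp
        moreover have "0 \<le> s / \<rho> p x" "s / \<rho> p x \<le> 1"
          using s False by (auto simp: divide_le_eq)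
        ultimately show ?thesis unfolding in_segment by blast
      qed
      then show ?thesis
        using s cs ds[of 0 s] by (simp add: comparison_point_def)
    qed
    have "z = b (\<rho> x z)" using b by (simp add: geodesic_path_def)
    then show "comparison_point \<rho> p (c ` {0..\<rho> p x}) (0 *\<^sub>R e) (\<rho> p x *\<^sub>R e) z (s *\<^sub>R e) \<or>
      comparison_point \<rho> x (b ` {0..\<rho> x z}) (\<rho> p x *\<^sub>R e) (s *\<^sub>R e) z (s *\<^sub>R e) \<or>
      comparison_point \<rho> z (a ` {0..\<rho> z p}) (s *\<^sub>R e) (0 *\<^sub>R e) z (s *\<^sub>R e)"
      using s z ds[of "\<rho> p x" s] commute[of x z]
      by (auto simp: comparison_point_def)
  qed (use assms a b c ds[of "\<rho> p x" s] ds[of s 0] ds[of 0 "\<rho> p x"] commute[of x z] commute[of z p] in \<open>auto simp: geodesic_segment_def\<close>)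
  then have "\<rho> (c s) z = 0"
    using nonneg[of "c s" z] by simp
  then show ?thesis
    using cs assms by simp
qed

definition geodesically_convex :: "'a set \<Rightarrow> bool" where
  "geodesically_convex C \<longleftrightarrow>
     C \<subseteq> X \<and> (\<forall>x\<in>C. \<forall>y\<in>C. \<forall>c. geodesic_path X \<rho> x y c \<longrightarrow> c ` {0..\<rho> x y} \<subseteq> C)"

text \<open>The parameter is the fraction of the way from \<open>p\<close> to \<open>x\<close>.  Keeping \<open>p\<close> as the starting point
  is what allows geodesics to different endpoints to be compared by a triangle with apex \<open>p\<close>.\<close>

definition interpolate :: "'a \<Rightarrow> 'a \<Rightarrow> real \<Rightarrow> 'a" where
  "interpolate p x t = (SOME c. geodesic_path X \<rho> p x c) (t * \<rho> p x)"

lemma interpolate_geodesic: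
  assumes "p \<in> X" "x \<in> X"
  obtains c where "geodesic_path X \<rho> p x c" "\<And>t. interpolate p x t = c (t * \<rho> p x)"
  using someI_ex[OF geodesic[OF assms]] by (metis interpolate_def)

lemma interpolate_endpoints:
  assumes "p \<in> X" "x \<in> X"
  shows "interpolate p x 0 = p" "interpolate p x 1 = x"
  using interpolate_geodesic[OF assms] by (metis geodesic_path_def mult_zero_left mult_1)+

lemma interpolate_in_convex:
  assumes "geodesically_convex C" "p \<in> C" "x \<in> C" "0 \<le> t" "t \<le> 1"
  shows "interpolate p x t \<in> C"
proof -
  have X: "p \<in> X" "x \<in> X" using assms by (auto simp: geodesically_convex_def)
  obtain c where c: "geodesic_path X \<rho> p x c" "\<And>t. interpolate p x t = c (t * \<rho> p x)"
    using interpolate_geodesic[OF X] by blast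
  have "t * \<rho> p x \<in> {0..\<rho> p x}"
    using assms by (auto simp: mult_left_le_one_le)
  moreover have "c ` {0..\<rho> p x} \<subseteq> C"
    using assms c(1) by (auto simp: geodesically_convex_def)
  ultimately show ?thesis
    using c(2) by auto
qed

lemma geodesically_convex_space: "geodesically_convex X"
  by (auto simp: geodesically_convex_def geodesic_path_def)

lemma interpolate_in_space:
  "\<lbrakk>p \<in> X; x \<in> X; 0 \<le> t; t \<le> 1\<rbrakk> \<Longrightarrow> interpolate p x t \<in> X"
  using interpolate_in_convex[OF geodesically_convex_space] .

text \<open>Joint control in the parameter and the endpoint: first move along one geodesic, then pass
  to the other at the same fraction, where the triangle comparison applies.\<close>

lemma interpolate_dist_le:
  assumes "p \<in> X" "x \<in> X" "y \<in> X" "0 \<le> s" "s \<le> 1" "0 \<le> t" "t \<le> 1"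
  shows "\<rho> (interpolate p x s) (interpolate p y t) \<le> \<bar>s - t\<bar> * \<rho> p x + \<rho> x y"
proof -
  obtain c where c: "geodesic_path X \<rho> p x c" "\<And>t. interpolate p x t = c (t * \<rho> p x)"
    using interpolate_geodesic assms by blast
  obtain c' where c': "geodesic_path X \<rho> p y c'" "\<And>t. interpolate p y t = c' (t * \<rho> p y)"
    using interpolate_geodesic assms by blast
  have I: "s * \<rho> p x \<in> {0..\<rho> p x}" "t * \<rho> p x \<in> {0..\<rho> p x}"
    using assms by (auto simp: mult_left_le_one_le)
  have "\<rho> (interpolate p x s) (interpolate p x t) = \<bar>s * \<rho> p x - t * \<rho> p x\<bar>"
    using c I by (auto simp: geodesic_path_def)
  also have "\<dots> = \<bar>s - t\<bar> * \<rho> p x"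
    by (simp add: abs_mult flip: left_diff_distrib)
  finally have 1: "\<rho> (interpolate p x s) (interpolate p x t) = \<bar>s - t\<bar> * \<rho> p x" .
  have "\<rho> (interpolate p x t) (interpolate p y t) \<le> t * \<rho> x y"
    using geodesics_from_point_contract[OF _ _ _ c(1) c'(1)] assms c c' by simp
  also have "\<dots> \<le> \<rho> x y"
    using assms by (simp add: mult_left_le_one_le)
  finally show ?thesis
    using 1 triangle[of "interpolate p x s" "interpolate p x t" "interpolate p y t"]
      interpolate_in_space assms by auto
qed

lemma continuous_map_interpolate:
  assumes p: "p \<in> X" and f: "continuous_map T mtopology f"
    and \<tau>: "continuous_map T euclideanreal \<tau>"
    and \<tau>01: "\<And>a. a \<in> topspace T \<Longrightarrow> 0 \<le> \<tau> a \<and> \<tau> a \<le> 1"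
  shows "continuous_map T mtopology (\<lambda>a. interpolate p (f a) (\<tau> a))"
  unfolding continuous_map_to_metric
proof (intro ballI allI impI)
  fix a and \<epsilon> :: real
  assume a: "a \<in> topspace T" and \<epsilon>: "\<epsilon> > 0"
  have fX: "f b \<in> X" if "b \<in> topspace T" for b
    using f that by (auto simp: continuous_map_def)
  \<comment> \<open>The summand \<open>1\<close> keeps \<open>D\<close> positive when \<open>f a = p\<close>.\<close>
  define D where "D = \<rho> p (f a) + 1"
  have D: "D > 0" by (simp add: D_def add_nonneg_pos)
  obtain U where U: "openin T U" "a \<in> U" "\<And>b. b \<in> U \<Longrightarrow> f b \<in> mball (f a) (\<epsilon> / 2)"
    using f a \<epsilon> unfolding continuous_map_to_metric by (meson half_gt_zero)
  define V where "V = {b \<in> topspace T. \<tau> b \<in> ball (\<tau> a) (\<epsilon> / (2 * D))}"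
  have V: "openin T V"
    unfolding V_def by (rule openin_continuous_map_preimage[OF \<tau>]) auto
  have "interpolate p (f b) (\<tau> b) \<in> mball (interpolate p (f a) (\<tau> a)) \<epsilon>" if "b \<in> U \<inter> V" for b
  proof -
    have b: "b \<in> topspace T" using that by (simp add: V_def)
    have "\<bar>\<tau> a - \<tau> b\<bar> < \<epsilon> / (2 * D)"
      using that by (simp add: V_def dist_real_def)
    then have "\<bar>\<tau> a - \<tau> b\<bar> * \<rho> p (f a) \<le> \<epsilon> / (2 * D) * D"
      by (intro mult_mono) (auto simp: D_def)
    also have "\<dots> = \<epsilon> / 2" using D by simp
    finally have "\<bar>\<tau> a - \<tau> b\<bar> * \<rho> p (f a) \<le> \<epsilon> / 2" .
    moreover have "\<rho> (f a) (f b) < \<epsilon> / 2" using U that by auto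
    ultimately have "\<rho> (interpolate p (f a) (\<tau> a)) (interpolate p (f b) (\<tau> b)) < \<epsilon>"
      using interpolate_dist_le[of p "f a" "f b" "\<tau> a" "\<tau> b"] p fX a b \<tau>01 by fastforce
    then show ?thesis
      using interpolate_in_space p fX a b \<tau>01 by simp
  qed
  moreover have "a \<in> U \<inter> V" using U a D \<epsilon> by (simp add: V_def)
  ultimately show "\<exists>U. openin T U \<and> a \<in> U \<and>
      (\<forall>b\<in>U. interpolate p (f b) (\<tau> b) \<in> mball (interpolate p (f a) (\<tau> a)) \<epsilon>)"
    using U(1) V by blast
qed


section \<open>Geodesic cones\<close>

text \<open>A continuous substitute for barycentric coordinates.  A weight \<open>1\<close> at \<open>p k\<close> moves the point
  all the way to \<open>p k\<close>, discarding what was built before, and a weight \<open>0\<close> leaves it unchanged.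
  Normalising weights to maximum \<open>1\<close>, instead of sum \<open>1\<close>, avoids dividing by partial sums; such
  quotients are discontinuous where the partial sum vanishes.\<close>

primrec iterated_cone :: "(nat \<Rightarrow> 'a) \<Rightarrow> (nat \<Rightarrow> real) \<Rightarrow> nat \<Rightarrow> 'a" where
  "iterated_cone p w 0 = p 0"
| "iterated_cone p w (Suc k) = interpolate (p (Suc k)) (iterated_cone p w k) (1 - w (Suc k))"

lemma iterated_cone_in_space:
  assumes "\<And>i. i \<le> k \<Longrightarrow> p i \<in> X" "\<And>i. i \<le> k \<Longrightarrow> 0 \<le> w i \<and> w i \<le> 1"
  shows "iterated_cone p w k \<in> X"
  using assms by (induction k) (auto intro!: interpolate_in_space)

lemma continuous_map_iterated_cone:
  assumes "\<And>i. i \<le> k \<Longrightarrow> p i \<in> X"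
    and "\<And>i. i \<le> k \<Longrightarrow> continuous_map T euclideanreal (\<lambda>a. w a i)"
    and "\<And>a i. \<lbrakk>a \<in> topspace T; i \<le> k\<rbrakk> \<Longrightarrow> 0 \<le> w a i \<and> w a i \<le> 1"
  shows "continuous_map T mtopology (\<lambda>a. iterated_cone p (w a) k)"
  using assms
proof (induction k)
  case 0
  then show ?case by simp
next
  case (Suc k)
  then show ?case
    by (auto intro!: continuous_map_interpolate continuous_intros)
qed

text \<open>The weight of \<open>p 0\<close> does not occur in the recursion, so \<open>p 0\<close> contributes even if \<open>w 0 = 0\<close>.
  This is why some weight has to be \<open>1\<close>: if \<open>w 0 = 0\<close>, then it belongs to a later point, which
  discards \<open>p 0\<close>.\<close>

lemma iterated_cone_in_convex:
  assumes C: "geodesically_convex C"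
    and X: "\<And>i. i \<le> k \<Longrightarrow> p i \<in> X" 
    and w: "\<And>i. i \<le> k \<Longrightarrow> 0 \<le> w i \<and> w i \<le> 1"
    and pos: "\<And>i. i \<le> k \<Longrightarrow> 0 < w i \<Longrightarrow> p i \<in> C"
    and one: "\<exists>i\<le>k. w i = 1"
  shows "iterated_cone p w k \<in> C"
  using X w pos one
proof (induction k)
  case 0
  then show ?case by auto
next
  case (Suc k)
  have cX: "iterated_cone p w k \<in> X"
    using Suc.prems by (intro iterated_cone_in_space) auto
  consider "w (Suc k) = 1" | "w (Suc k) = 0" "\<exists>i\<le>k. w i = 1"
    | "0 < w (Suc k)" "w (Suc k) \<le> 1" "\<exists>i\<le>k. w i = 1"
    using Suc.prems(2)[of "Suc k"] Suc.prems(4) by (metis le_Suc_eq less_eq_real_def order_refl)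
  then show ?case
  proof cases
    case 1
    then show ?thesis
      using Suc.prems interpolate_endpoints(1) cX by auto
  next
    case 2
    then show ?thesis
      using Suc interpolate_endpoints(2)[OF _ cX] by auto
  next
    case 3
    then show ?thesis
      using Suc by (auto intro!: interpolate_in_convex[OF C])
  qed
qed


section \<open>Distance to a set\<close>

definition dist_to_set :: "'a set \<Rightarrow> 'a \<Rightarrow> real" where
  "dist_to_set C x = (INF y\<in>C. \<rho> x y)"

lemma dist_to_set_nonneg: "C \<noteq> {} \<Longrightarrow> 0 \<le> dist_to_set C x"
  unfolding dist_to_set_def by (intro cINF_greatest) auto

lemma dist_to_set_le: "y \<in> C \<Longrightarrow> dist_to_set C x \<le> \<rho> x y"
  unfolding dist_to_set_def by (rule cINF_lower) (auto intro: bdd_belowI2[of _ 0])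

lemma dist_to_set_eq_0_iff:
  assumes "closedin mtopology C" "C \<noteq> {}" "x \<in> X"
  shows "dist_to_set C x = 0 \<longleftrightarrow> x \<in> C"
proof
  assume "x \<in> C"
  then show "dist_to_set C x = 0"
    using dist_to_set_le[of x C x] dist_to_set_nonneg[of C x] assms by fastforce
next
  assume 0: "dist_to_set C x = 0"
  show "x \<in> C"
  proof (rule ccontr)
    assume "x \<notin> C"
    then obtain r where r: "r > 0" "disjnt C (mball x r)" and CX: "C \<subseteq> X"
      using assms by (auto simp: closedin_metric)
    have "r \<le> \<rho> x y" if "y \<in> C" for y
      using r CX that assms by (fastforce simp: disjnt_iff)
    then have "r \<le> dist_to_set C x"
      unfolding dist_to_set_def using assms by (intro cINF_greatest) auto
    with 0 r show False by simp
  qed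
qed

lemma dist_to_set_triangle:
  assumes "C \<subseteq> X" "C \<noteq> {}" "x \<in> X" "y \<in> X"
  shows "dist_to_set C x \<le> \<rho> x y + dist_to_set C y"
proof -
  have "dist_to_set C x - \<rho> x y \<le> \<rho> y z" if "z \<in> C" for z
    using dist_to_set_le[OF that, of x] triangle[of x y z] that assms by auto
  then have "dist_to_set C x - \<rho> x y \<le> dist_to_set C y"
    unfolding dist_to_set_def[of C y] using assms by (intro cINF_greatest) auto
  then show ?thesis by simp
qed

lemma continuous_map_dist_to_set:
  assumes "C \<subseteq> X" "C \<noteq> {}"
  shows "continuous_map mtopology euclideanreal (dist_to_set C)"
  unfolding continuous_map_from_metric
proof (intro conjI ballI allI impI)
  fix x U assume x: "x \<in> X" and "openin euclideanreal U \<and> dist_to_set C x \<in> U"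
  then obtain \<epsilon> where "\<epsilon> > 0" and U: "\<And>u. dist u (dist_to_set C x) < \<epsilon> \<Longrightarrow> u \<in> U"
    by (auto simp: open_dist)
  moreover have "dist (dist_to_set C y) (dist_to_set C x) \<le> \<rho> x y" if "y \<in> X" for y
    using dist_to_set_triangle[OF assms x that] dist_to_set_triangle[OF assms that x]
    by (simp add: dist_real_def commute)
  ultimately show "\<exists>r>0. \<forall>y. y \<in> X \<and> \<rho> x y < r \<longrightarrow> dist_to_set C y \<in> U"
    by (meson order_le_less_trans)
qed auto

end


section \<open>Maps into spheres\<close>

definition normalise :: "nat \<Rightarrow> (nat \<Rightarrow> real) \<Rightarrow> nat \<Rightarrow> real" where
  "normalise n v = (\<lambda>i. if i \<le> n then v i / sqrt (\<Sum>j\<le>n. (v j)\<^sup>2) else 0)"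

lemma topspace_nsphere:
  "v \<in> topspace (nsphere n) \<longleftrightarrow> (\<Sum>i\<le>n. (v i)\<^sup>2) = 1 \<and> (\<forall>i>n. v i = 0)"
  by (simp add: nsphere)

lemma sum_squares_pos:
  fixes v :: "nat \<Rightarrow> real"
  assumes "i \<le> n" "v i \<noteq> 0"
  shows "0 < (\<Sum>j\<le>n. (v j)\<^sup>2)"
  using assms by (intro sum_pos2[of _ i]) auto

lemma normalise_nsphere:
  assumes "v \<in> topspace (nsphere n)"
  shows "normalise n v = v"
  using assms by (auto simp: topspace_nsphere normalise_def fun_eq_iff)

lemma continuous_map_normalise:
  assumes cont: "\<And>i. i \<le> n \<Longrightarrow> continuous_map T euclideanreal (\<lambda>a. w a i)"
    and nz: "\<And>a. a \<in> topspace T \<Longrightarrow> \<exists>i\<le>n. w a i \<noteq> 0"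
  shows "continuous_map T (nsphere n) (\<lambda>a. normalise n (w a))"
proof -
  have pos: "0 < (\<Sum>j\<le>n. (w a j)\<^sup>2)" if "a \<in> topspace T" for a
    using nz[OF that] sum_squares_pos by blast
  have "continuous_map T euclideanreal (\<lambda>a. normalise n (w a) i)" for i
  proof (cases "i \<le> n")
    case True
    have "sqrt (\<Sum>j\<le>n. (w a j)\<^sup>2) \<noteq> 0" if "a \<in> topspace T" for a
      using pos[OF that] by simp
    then show ?thesis
      using True unfolding normalise_def
      by (auto intro!: continuous_intros cont)
  next
    case False
    then show ?thesis by (simp add: normalise_def)
  qed
  moreover have "(\<Sum>i\<le>n. (normalise n (w a) i)\<^sup>2) = 1" if "a \<in> topspace T" for a
  proof -
    have "(\<Sum>i\<le>n. (normalise n (w a) i)\<^sup>2) = (\<Sum>i\<le>n. (w a i)\<^sup>2 / (\<Sum>j\<le>n. (w a j)\<^sup>2))"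
      using pos[OF that] by (intro sum.cong) (auto simp: normalise_def power_divide)
    also have "\<dots> = 1"
      using pos[OF that] by (simp flip: sum_divide_distrib)
    finally show ?thesis .
  qed
  ultimately show ?thesis
    by (auto simp: nsphere continuous_map_in_subtopology continuous_map_componentwise_UNIV normalise_def)
qed

text \<open>The straight segment from \<open>v\<close> to \<open>e v\<close> avoids the origin unless \<open>e v\<close> is the antipode
  of \<open>v\<close>, so it can be projected radially to the sphere.\<close>

lemma not_antipodal_imp_homotopic_id:
  assumes e: "continuous_map (nsphere n) (nsphere n) e"
    and ne: "\<And>v. v \<in> topspace (nsphere n) \<Longrightarrow> e v \<noteq> (\<lambda>i. - v i)"
  shows "homotopic_with (\<lambda>_. True) (nsphere n) (nsphere n) id e"
proof -
  define w :: "real \<times> (nat \<Rightarrow> real) \<Rightarrow> nat \<Rightarrow> real"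
    where "w = (\<lambda>(t, v) i. (1 - t) * v i + t * e v i)"
  let ?T = "prod_topology (top_of_set {0..1::real}) (nsphere n)"
  have eS: "e v \<in> topspace (nsphere n)" if "v \<in> topspace (nsphere n)" for v
    using e that by (auto simp: continuous_map_def)
  have "continuous_map ?T (nsphere n) (\<lambda>a. normalise n (w a))"
  proof (rule continuous_map_normalise)
    fix i
    have 1: "continuous_map ?T euclideanreal fst"
      by (rule continuous_map_into_fulltopology[OF continuous_map_fst])
    have 2: "continuous_map ?T euclideanreal (\<lambda>a. snd a i)"
      using continuous_map_compose[OF continuous_map_snd continuous_map_nsphere_projection]
      by (simp add: o_def)
    have 3: "continuous_map ?T euclideanreal (\<lambda>a. e (snd a) i)"
      using continuous_map_compose[OF continuous_map_compose[OF continuous_map_snd e]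
          continuous_map_nsphere_projection]
      by (simp add: o_def)
    show "continuous_map ?T euclideanreal (\<lambda>a. w a i)"
      unfolding w_def case_prod_unfold
      by (intro continuous_intros 1 2 3)
  next
    fix a assume "a \<in> topspace ?T"
    then obtain t v where a: "a = (t, v)" and t: "0 \<le> t" "t \<le> 1" and v: "v \<in> topspace (nsphere n)"
      by auto
    show "\<exists>i\<le>n. w a i \<noteq> 0"
    proof (rule ccontr)
      assume "\<not> ?thesis"
      then have eq: "(1 - t) * v i = - (t * e v i)" if "i \<le> n" for i
        using that a by (auto simp: w_def)
      \<comment> \<open>Both \<open>v\<close> and \<open>e v\<close> have norm one, so the two coefficients must agree.\<close>
      have "(\<Sum>i\<le>n. ((1 - t) * v i)\<^sup>2) = (\<Sum>i\<le>n. (t * e v i)\<^sup>2)"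
        by (intro sum.cong) (auto simp: eq)
      then have "(1 - t)\<^sup>2 * (\<Sum>i\<le>n. (v i)\<^sup>2) = t\<^sup>2 * (\<Sum>i\<le>n. (e v i)\<^sup>2)"
        by (simp add: power_mult_distrib sum_distrib_left)
      then have "(1 - t)\<^sup>2 = t\<^sup>2"
        using v eS[OF v] by (simp add: topspace_nsphere)
      then have "t = 1/2"
        using t by (simp add: power2_eq_iff)
      then have "e v i = - v i" if "i \<le> n" for i
        using eq[OF that] unfolding \<open>t = 1/2\<close> by simp
      moreover have "e v i = - v i" if "i > n" for i
        using v eS[OF v] that by (simp add: topspace_nsphere)
      ultimately have "e v = (\<lambda>i. - v i)"
        by (meson ext not_le)
      with ne v show False by blast
    qed
  qed
  moreover have "normalise n (w (0, v)) = v" "normalise n (w (1, v)) = e v"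
    if "v \<in> topspace (nsphere n)" for v
    using that eS by (simp_all add: w_def normalise_nsphere)
  ultimately show ?thesis
    by (subst homotopic_with) auto
qed

lemma not_antipodal_imp_not_nullhomotopic:
  assumes "continuous_map (nsphere n) (nsphere n) e"
    and "\<And>v. v \<in> topspace (nsphere n) \<Longrightarrow> e v \<noteq> (\<lambda>i. - v i)"
  shows "\<not> homotopic_with (\<lambda>_. True) (nsphere n) (nsphere n) e (\<lambda>_. c)"
  using homotopic_with_trans[OF not_antipodal_imp_homotopic_id[OF assms]]
    non_contractible_space_nsphere[of n]
  by (auto simp: contractible_space_def)

text \<open>Rescales the values of \<open>v\<close> on \<open>{..n}\<close> affinely so that they have minimum \<open>0\<close> and
  maximum \<open>1\<close>.  It is used on points of the \<open>(n - 1)\<close>-sphere, which have coordinate \<open>0\<close> at \<open>n\<close>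
  and are thus treated as functions on \<open>n + 1\<close> indices; up to scaling this
  identifies the sphere with the boundary of the \<open>n\<close>-simplex.\<close>

definition spread_weights :: "nat \<Rightarrow> (nat \<Rightarrow> real) \<Rightarrow> nat \<Rightarrow> real" where
  "spread_weights n v i =
     (v i - (INF j\<in>{..n}. v j)) / ((SUP j\<in>{..n}. v j) - (INF j\<in>{..n}. v j))"

text \<open>A point of the sphere is not constant on \<open>{..Suc n}\<close>, since it is nonzero but vanishes at
  \<open>Suc n\<close>.\<close>

lemma Inf_less_Sup_on_nsphere:
  assumes "v \<in> topspace (nsphere n)"
  shows "(INF j\<in>{..Suc n}. v j) < (SUP j\<in>{..Suc n}. v j)"
proof -
  have "v (Suc n) = 0" using assms by (simp add: topspace_nsphere)
  moreover obtain i where "i \<le> n" "v i \<noteq> 0"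
  proof (rule ccontr)
    assume "\<not> thesis"
    then have "(\<Sum>i\<le>n. (v i)\<^sup>2) = 0" using that by (intro sum.neutral) auto
    then show False using assms by (simp add: topspace_nsphere)
  qed
  moreover have "(INF j\<in>{..Suc n}. v j) \<le> v k" "v k \<le> (SUP j\<in>{..Suc n}. v j)" if "k \<le> Suc n" for k
    using that by (auto intro!: cINF_lower cSUP_upper)
  ultimately show ?thesis
    by (smt (verit) le_Suc_eq)
qed

lemma spread_weights_range:
  assumes "v \<in> topspace (nsphere n)" "i \<le> Suc n"
  shows "0 \<le> spread_weights (Suc n) v i \<and> spread_weights (Suc n) v i \<le> 1"
proof -
  have "(INF j\<in>{..Suc n}. v j) \<le> v i" "v i \<le> (SUP j\<in>{..Suc n}. v j)"
    using assms by (auto intro!: cINF_lower cSUP_upper)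
  then show ?thesis
    using Inf_less_Sup_on_nsphere[OF assms(1)] by (simp add: spread_weights_def)
qed

lemma spread_weights_extremes:
  assumes "v \<in> topspace (nsphere n)"
  obtains i j where "i \<le> Suc n" "spread_weights (Suc n) v i = 1"
    "j \<le> Suc n" "spread_weights (Suc n) v j = 0" "\<And>k. k \<le> Suc n \<Longrightarrow> v j \<le> v k"
proof -
  have eq: "(INF j\<in>{..Suc n}. v j) = Min (v ` {..Suc n})" "(SUP j\<in>{..Suc n}. v j) = Max (v ` {..Suc n})"
    by (auto intro: cInf_eq_Min cSup_eq_Max)
  obtain i where "i \<le> Suc n" "v i = Max (v ` {..Suc n})"
    using Max_in[of "v ` {..Suc n}"] by fastforce
  moreover obtain j where "j \<le> Suc n" "v j = Min (v ` {..Suc n})"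
    using Min_in[of "v ` {..Suc n}"] by fastforce
  moreover have "Min (v ` {..Suc n}) \<le> v k" if "k \<le> Suc n" for k
    using that by auto
  ultimately show ?thesis
    using that[of i j] Inf_less_Sup_on_nsphere[OF assms] by (simp add: spread_weights_def eq)
qed

lemma continuous_map_spread_weights:
  "continuous_map (nsphere n) euclideanreal (\<lambda>v. spread_weights (Suc n) v i)"
  unfolding spread_weights_def using Inf_less_Sup_on_nsphere[of _ n]
  by (intro continuous_intros continuous_map_nsphere_projection) force+


section \<open>Helly's theorem\<close>

context CAT0_space
begin

text \<open>If the sets had no common point, then the distances to the sets and the geodesic cone over
  the points \<open>p i\<close> would combine to a map from the \<open>r\<close>-sphere to itself that is both nullhomotopic
  and without antipodal values.\<close>

lemma helly_step:
  assumes dim: "covering_dim_le mtopology d" "d \<le> r"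
    and closed: "\<And>i. i \<le> Suc r \<Longrightarrow> closedin mtopology (C i)"
    and convex: "\<And>i. i \<le> Suc r \<Longrightarrow> geodesically_convex (C i)"
    and p: "\<And>i j. \<lbrakk>i \<le> Suc r; j \<le> Suc r; i \<noteq> j\<rbrakk> \<Longrightarrow> p i \<in> C j"
  shows "(\<Inter>i\<le>Suc r. C i) \<noteq> {}"
proof
  assume empty: "(\<Inter>i\<le>Suc r. C i) = {}"
  have ne: "C i \<noteq> {}" if "i \<le> Suc r" for i
  proof -
    have "p (if i = 0 then 1 else 0) \<in> C i" using p that by simp
    then show ?thesis by blast
  qed
  have CX: "C i \<subseteq> X" if "i \<le> Suc r" for i
    using convex[OF that] by (simp add: geodesically_convex_def)
  have pX: "p i \<in> X" if "i \<le> Suc r" for i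
    using p[of i 0] p[of i 1] CX[of 0] CX[of 1] that by (cases "i = 0") auto
  define \<phi> where "\<phi> i = dist_to_set (C i)" for i
  have \<phi>0: "\<phi> i x = 0 \<longleftrightarrow> x \<in> C i" if "i \<le> Suc r" "x \<in> X" for i x
    using dist_to_set_eq_0_iff closed ne that by (simp add: \<phi>_def)
  define K where "K = (\<Union>i\<le>Suc r. C i)"
  have K: "closedin mtopology K"
    unfolding K_def by (rule closedin_Union) (use closed in auto)
  define w where "w x i = \<phi> i x - \<phi> (Suc r) x" for x i
  \<comment> \<open>On \<open>K\<close> one of the distances vanishes, so if they all agreed, they would all vanish.\<close>
  have wnz: "\<exists>i\<le>r. w x i \<noteq> 0" if "x \<in> K" for x
  proof (rule ccontr)
    assume "\<not> ?thesis"
    then have eq: "\<phi> i x = \<phi> (Suc r) x" if "i \<le> Suc r" for i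
      using that by (auto simp: w_def le_Suc_eq)
    obtain j where "j \<le> Suc r" "x \<in> C j" using \<open>x \<in> K\<close> by (auto simp: K_def)
    then have "\<phi> i x = 0" if "i \<le> Suc r" for i
      using eq \<phi>0 CX that by (metis subsetD)
    then have "x \<in> (\<Inter>i\<le>Suc r. C i)"
      using \<phi>0 CX \<open>j \<le> Suc r\<close> \<open>x \<in> C j\<close> by blast
    with empty show False by blast
  qed
  have "continuous_map (subtopology mtopology K) (nsphere r) (\<lambda>x. normalise r (w x))"
  proof (rule continuous_map_normalise)
    show "continuous_map (subtopology mtopology K) euclideanreal (\<lambda>x. w x i)" if "i \<le> r" for i
      unfolding w_def \<phi>_def using that CX ne
      by (intro continuous_intros continuous_map_from_subtopology continuous_map_dist_to_set) auto
  qed (use wnz in auto)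
  then obtain g where g: "continuous_map mtopology (nsphere r) g"
    and gK: "\<And>x. x \<in> K \<Longrightarrow> g x = normalise r (w x)"
    using dim(1)[unfolded covering_dim_le_def, rule_format, of K r "\<lambda>x. normalise r (w x)"] K dim(2)
    by auto

  \<comment> \<open>Increasing \<open>t\<close> from \<open>0\<close> to \<open>1\<close> raises every weight to \<open>1\<close>, where the last cone point
    \<open>p (Suc r)\<close> absorbs everything.\<close>
  define h where "h t v = iterated_cone p (\<lambda>i. (1 - t) * spread_weights (Suc r) v i + t) (Suc r)"
    for t v
  let ?T = "prod_topology (top_of_set {0..1::real}) (nsphere r)"
  have h: "continuous_map ?T mtopology (\<lambda>a. h (fst a) (snd a))"
    unfolding h_def
  proof (rule continuous_map_iterated_cone)
    fix i assume "i \<le> Suc r"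
    have 1: "continuous_map ?T euclideanreal fst"
      by (rule continuous_map_into_fulltopology[OF continuous_map_fst])
    have 2: "continuous_map ?T euclideanreal (\<lambda>a. spread_weights (Suc r) (snd a) i)"
      using continuous_map_compose[OF continuous_map_snd continuous_map_spread_weights]
      by (simp add: o_def)
    show "continuous_map ?T euclideanreal
        (\<lambda>a. (1 - fst a) * spread_weights (Suc r) (snd a) i + fst a)"
      by (intro continuous_intros 1 2)
  next
    fix a i assume a: "a \<in> topspace ?T" and i: "i \<le> Suc r"
    then have "0 \<le> fst a" "fst a \<le> 1" "snd a \<in> topspace (nsphere r)" by auto
    with spread_weights_range[OF this(3) i]
    show "0 \<le> (1 - fst a) * spread_weights (Suc r) (snd a) i + fst a \<and>
        (1 - fst a) * spread_weights (Suc r) (snd a) i + fst a \<le> 1"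
      using convex_bound_le[of "spread_weights (Suc r) (snd a) i" 1 1 "1 - fst a" "fst a"] by simp
  qed (use pX in auto)
  have gh: "continuous_map ?T (nsphere r) (\<lambda>a. g (h (fst a) (snd a)))"
    using continuous_map_compose[OF h g] by (simp add: o_def)
  have h1: "h 1 v = p (Suc r)" for v
  proof -
    have "iterated_cone p (\<lambda>_. 1) r \<in> X"
      using pX by (intro iterated_cone_in_space) auto
    then show ?thesis
      using interpolate_endpoints(1) pX by (simp add: h_def)
  qed
  define e where "e v = g (h 0 v)" for v
  have null: "homotopic_with (\<lambda>_. True) (nsphere r) (nsphere r) e (\<lambda>_. g (p (Suc r)))"
    unfolding homotopic_with_def
    by (rule exI[of _ "\<lambda>a. g (h (fst a) (snd a))"]) (simp add: gh h1 e_def)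
  have "e v \<noteq> (\<lambda>i. - v i)" if v: "v \<in> topspace (nsphere r)" for v
  proof
    assume eq: "e v = (\<lambda>i. - v i)"
    define x where "x = h 0 v"
    define W where "W = spread_weights (Suc r) v"
    obtain i j where i: "i \<le> Suc r" "W i = 1" and j: "j \<le> Suc r" "W j = 0"
      and min: "\<And>k. k \<le> Suc r \<Longrightarrow> v j \<le> v k"
      using spread_weights_extremes[OF v] unfolding W_def by metis
    have xW: "x = iterated_cone p W (Suc r)"
      by (simp add: x_def h_def W_def)
    \<comment> \<open>The only \<open>p l\<close> that may lie outside \<open>C k\<close> is \<open>p k\<close>, and its weight is zero.\<close>
    have xC: "x \<in> C k" if "k \<le> Suc r" "W k = 0" for k
      unfolding xW
    proof (rule iterated_cone_in_convex)
      show "p l \<in> C k" if "l \<le> Suc r" "0 < W l" for l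
        using p[of l k] that \<open>k \<le> Suc r\<close> \<open>W k = 0\<close> by (cases "l = k") auto
    qed (use convex pX that spread_weights_range[OF v] i in \<open>auto simp: W_def\<close>)
    then have "x \<in> C j" using j by blast
    then have xK: "x \<in> K" and xX: "x \<in> X" using j CX by (auto simp: K_def)
    define s where "s = sqrt (\<Sum>k\<le>r. (w x k)\<^sup>2)"
    have s: "s > 0"
      using wnz[OF xK] sum_squares_pos by (auto simp: s_def)
    have wv: "w x k = - s * v k" if "k \<le> Suc r" for k
    proof (cases "k = Suc r")
      case True
      then show ?thesis using v by (simp add: w_def topspace_nsphere)
    next
      case False
      then have "k \<le> r" using that by simp
      have "normalise r (w x) k = - v k"
        using fun_cong[OF eq, of k] gK[OF xK] by (simp add: e_def x_def)
      then show ?thesis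
        using \<open>k \<le> r\<close> s by (simp add: normalise_def s_def[symmetric] field_simps)
    qed
    have "\<phi> j x = 0" using \<open>x \<in> C j\<close> \<phi>0 j xX by simp
    \<comment> \<open>\<open>\<phi>\<close> is now a decreasing affine function of the coordinates of \<open>v\<close>, and it is zero already
      where \<open>v\<close> is smallest.\<close>
    have "\<phi> k x = 0" if "k \<le> Suc r" for k
    proof -
      have "\<phi> k x - \<phi> j x = s * (v j - v k)"
        using wv[OF that] wv[OF j(1)] by (simp add: w_def algebra_simps)
      also have "\<dots> \<le> 0"
        using s min[OF that] by (simp add: mult_nonneg_nonpos)
      finally show ?thesis
        using \<open>\<phi> j x = 0\<close> dist_to_set_nonneg[OF ne[OF that], of x] by (simp add: \<phi>_def)
    qed
    then have "x \<in> (\<Inter>k\<le>Suc r. C k)" using \<phi>0 xX by blast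
    with empty show False by blast
  qed
  moreover have "continuous_map (nsphere r) (nsphere r) e"
    using homotopic_with_imp_continuous_maps[OF null] by blast
  ultimately show False
    using not_antipodal_imp_not_nullhomotopic null by blast
qed


text \<open>Since \<open>helly_step\<close> applies to every \<open>r \<ge> d\<close>, a family of more than \<open>d + 1\<close> sets can be treated
  in one step: by induction, removing any one member leaves a family with a common point.\<close>

theorem helly:
  assumes dim: "covering_dim_le mtopology d" and "finite I"
    and closed: "\<And>i. i \<in> I \<Longrightarrow> closedin mtopology (C i)"
    and convex: "\<And>i. i \<in> I \<Longrightarrow> geodesically_convex (C i)"
    and small: "\<And>J. \<lbrakk>J \<subseteq> I; card J \<le> d + 1\<rbrakk> \<Longrightarrow> X \<inter> (\<Inter>i\<in>J. C i) \<noteq> {}"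
  shows "X \<inter> (\<Inter>i\<in>I. C i) \<noteq> {}"
  using assms(2-)
proof (induction I rule: finite_psubset_induct)
  case (psubset I)
  show ?case
  proof (cases "card I \<le> d + 1")
    case True
    then show ?thesis using psubset.prems(3) by blast
  next
    case False
    define r where "r = card I - 2"
    have r: "card I = Suc (Suc r)" "d \<le> r"
      using False by (auto simp: r_def)
    obtain b where "bij_betw b {0..<card I} I"
      using ex_bij_betw_nat_finite[OF \<open>finite I\<close>] by blast
    then have b: "bij_betw b {..Suc r} I"
      by (simp add: r atLeast0LessThan lessThan_Suc_atMost)
    have "\<exists>x. x \<in> X \<inter> (\<Inter>i\<in>I - {b k}. C i)" if "k \<le> Suc r" for k
    proof -
      have "I - {b k} \<subset> I" using b that by (auto simp: bij_betw_def)
      then have "X \<inter> (\<Inter>i\<in>I - {b k}. C i) \<noteq> {}"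
        by (rule psubset.IH) (meson psubset.prems Diff_subset subset_trans DiffD1)+
      then show ?thesis by blast
    qed
    then obtain p where p: "\<And>k. k \<le> Suc r \<Longrightarrow> p k \<in> X \<inter> (\<Inter>i\<in>I - {b k}. C i)"
      by metis
    have "(\<Inter>k\<le>Suc r. C (b k)) \<noteq> {}"
    proof (rule helly_step[OF dim \<open>d \<le> r\<close>])
      show "p k \<in> C (b l)" if "k \<le> Suc r" "l \<le> Suc r" "k \<noteq> l" for k l
      proof -
        have "b l \<in> I - {b k}"
          using b that by (auto simp: bij_betw_def inj_on_def)
        then show ?thesis using p[OF that(1)] by blast
      qed
    qed (use b psubset.prems in \<open>auto simp: bij_betw_def\<close>)
    then obtain x where x: "x \<in> (\<Inter>k\<le>Suc r. C (b k))"
      by (meson ex_in_conv)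
    have "x \<in> C (b 0)" "C (b 0) \<subseteq> X"
      using x b psubset.prems(2) by (auto simp: bij_betw_def geodesically_convex_def)
    moreover have "(\<Inter>k\<le>Suc r. C (b k)) = (\<Inter>i\<in>I. C i)"
      using b unfolding bij_betw_def by (metis image_image)
    ultimately show ?thesis
      using x by (metis IntI empty_iff subsetD)
  qed
qed


section \<open>Fixed points of isometries\<close>

lemma fixed_points_closed:
  assumes maps: "\<And>f x. f \<in> F \<Longrightarrow> x \<in> X \<Longrightarrow> f x \<in> X"
    and iso: "\<And>f x y. \<lbrakk>f \<in> F; x \<in> X; y \<in> X\<rbrakk> \<Longrightarrow> \<rho> (f x) (f y) = \<rho> x y"
  shows "closedin mtopology {x \<in> X. \<forall>f\<in>F. f x = x}"
  unfolding closedin_metric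
proof (intro conjI allI impI)
  fix x assume "x \<in> X - {x \<in> X. \<forall>f\<in>F. f x = x}"
  then obtain f where x: "x \<in> X" and f: "f \<in> F" "f x \<noteq> x" by auto
  have "\<rho> x (f x) \<le> 2 * \<rho> x y" if "y \<in> X" "f y = y" for y
    using triangle[of x y "f x"] iso[OF f(1) that(1) x] maps[OF f(1) x] that x
    by (simp add: commute)
  then have "disjnt {x \<in> X. \<forall>f\<in>F. f x = x} (mball x (\<rho> x (f x) / 2))"
    using f(1) by (force simp: disjnt_iff)
  moreover have "\<rho> x (f x) / 2 > 0"
    using x f maps by (metis half_gt_zero mdist_pos_less)
  ultimately show "\<exists>r>0. disjnt {x \<in> X. \<forall>f\<in>F. f x = x} (mball x r)"
    by blast
qed auto

text \<open>The image of a point on the geodesic from \<open>x\<close> to \<open>y\<close> under an isometry fixing \<open>x\<close> and \<open>y\<close>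
  has the same distances to \<open>x\<close> and \<open>y\<close>, so it is the same point.\<close>

lemma fixed_points_convex:
  assumes maps: "\<And>f x. f \<in> F \<Longrightarrow> x \<in> X \<Longrightarrow> f x \<in> X"
    and iso: "\<And>f x y. \<lbrakk>f \<in> F; x \<in> X; y \<in> X\<rbrakk> \<Longrightarrow> \<rho> (f x) (f y) = \<rho> x y"
  shows "geodesically_convex {x \<in> X. \<forall>f\<in>F. f x = x}"
  unfolding geodesically_convex_def
proof (intro conjI ballI allI impI subsetI)
  fix x y c z
  assume "x \<in> {x \<in> X. \<forall>f\<in>F. f x = x}" "y \<in> {x \<in> X. \<forall>f\<in>F. f x = x}"
    and c: "geodesic_path X \<rho> x y c" and "z \<in> c ` {0..\<rho> x y}"
  then obtain s where xy: "x \<in> X" "y \<in> X" "\<And>f. f \<in> F \<Longrightarrow> f x = x" "\<And>f. f \<in> F \<Longrightarrow> f y = y"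
    and s: "s \<in> {0..\<rho> x y}" "z = c s" by auto
  have z: "z \<in> X" and dz: "\<rho> x z = s" "\<rho> z y = \<rho> x y - s"
    using geodesic_path_point[OF c] s by auto
  have "f z = z" if "f \<in> F" for f
  proof -
    have "\<rho> x (f z) = s" "\<rho> (f z) y = \<rho> x y - s"
      using iso[OF that xy(1) z] iso[OF that z xy(2)] xy(3,4)[OF that] dz by simp_all
    then show ?thesis
      using geodesic_point_unique[OF xy(1,2) maps[OF that z] c] s by auto
  qed
  then show "z \<in> {x \<in> X. \<forall>f\<in>F. f x = x}" using z by blast
qed auto

end

lemma fixed_by_generate:
  assumes "group G" and hom: "\<phi> \<in> hom G (isometry_group X \<rho>)"
    and S: "S \<subseteq> carrier G" and x: "x \<in> X" and fix_S: "\<And>a. a \<in> S \<Longrightarrow> \<phi> a x = x"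
    and h: "h \<in> generate G S"
  shows "\<phi> h x = x"
proof -
  have one_iso: "\<one>\<^bsub>isometry_group X \<rho>\<^esub> = (\<lambda>x\<in>X. x)"
    by (simp add: isometry_group_def BijGroup_def)
  interpret G: group G by fact
  interpret \<phi>: group_hom G "isometry_group X \<rho>" \<phi>
    using hom by (simp add: group_hom_def group_hom_axioms_def group_isometry_group G.group_axioms)
  have comp: "\<phi> (a \<otimes>\<^bsub>G\<^esub> b) x = \<phi> a (\<phi> b x)" if "a \<in> carrier G" "b \<in> carrier G" for a b
    using \<phi>.hom_mult[OF that] \<phi>.hom_closed[OF that(1)] \<phi>.hom_closed[OF that(2)] x
    by (simp add: isometry_group_def BijGroup_def compose_def)
  have one: "\<phi> \<one>\<^bsub>G\<^esub> x = x"
    unfolding \<phi>.hom_one one_iso using x by simp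
  show ?thesis
    using h
  proof (induction h rule: generate.induct)
    case (inv a)
    then have "a \<in> carrier G" using S by blast
    then have "\<phi> (inv\<^bsub>G\<^esub> a) (\<phi> a x) = x"
      using comp[of "inv\<^bsub>G\<^esub> a" a] one by simp
    then show ?case using fix_S[OF inv] by simp
  next
    case (eng a b)
    then show ?case
      using comp G.generate_in_carrier[OF S] by simp
  qed (simp_all add: one_iso x fix_S)
qed

theorem proposition3p1:
  fixes d m :: nat
    and G :: "('g, 'e) monoid_scheme"
    and A :: "nat \<Rightarrow> 'g set"
    and X :: "'a set"
    and \<rho> :: "'a \<Rightarrow> 'a \<Rightarrow> real"
    and \<phi> :: "'g \<Rightarrow> 'a \<Rightarrow> 'a"
  assumes "group G"
    and "\<And>i. i \<in> {1..m} \<Longrightarrow> A i \<subseteq> carrier G"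
    and "generate G (\<Union>i\<in>{1..m}. A i) = carrier G"
    and "CAT0_space X \<rho>"
    and "Metric_space.mcomplete X \<rho>"
    and "covering_dim_le (Metric_space.mtopology X \<rho>) d"
    and "\<phi> \<in> hom G (isometry_group X \<rho>)"
    and "\<And>I. \<lbrakk>I \<subseteq> {1..m}; card I \<le> d + 1\<rbrakk> \<Longrightarrow> has_fixed_point X \<phi> (generate G (\<Union>i\<in>I. A i))"
  shows "has_fixed_point X \<phi> (carrier G)"
proof -
  interpret CAT0_space X \<rho> by fact
  define Fix where "Fix i = {x \<in> X. \<forall>f\<in>\<phi> ` A i. f x = x}" for i
  have isom: "f x \<in> X" "\<rho> (f x) (f y) = \<rho> x y"
    if "i \<in> {1..m}" "f \<in> \<phi> ` A i" "x \<in> X" "y \<in> X" for i f x y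
  proof -
    have "f \<in> carrier (isometry_group X \<rho>)"
      using that assms(2) assms(7) by (auto simp: hom_def)
    then show "f x \<in> X" "\<rho> (f x) (f y) = \<rho> x y"
      using that Bij_imp_funcset by (fastforce simp: isometry_group_def)+
  qed
  have "X \<inter> (\<Inter>i\<in>{1..m}. Fix i) \<noteq> {}"
  proof (rule helly[OF assms(6)])
    fix J assume "J \<subseteq> {1..m}" "card J \<le> d + 1"
    then obtain x where "x \<in> X" "\<forall>h\<in>generate G (\<Union>i\<in>J. A i). \<phi> h x = x"
      using assms(8)[of J] unfolding has_fixed_point_def by blast
    then have "x \<in> X \<inter> (\<Inter>i\<in>J. Fix i)"
      by (auto simp: Fix_def intro: generate.incl)
    then show "X \<inter> (\<Inter>i\<in>J. Fix i) \<noteq> {}" by blast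
  next
    show "closedin mtopology (Fix i)" "geodesically_convex (Fix i)" if "i \<in> {1..m}" for i
      unfolding Fix_def using isom[OF that]
      by (blast intro: fixed_points_closed fixed_points_convex)+
  qed simp
  then obtain x where x: "x \<in> X" "\<And>i a. i \<in> {1..m} \<Longrightarrow> a \<in> A i \<Longrightarrow> \<phi> a x = x"
    unfolding Fix_def by blast
  have "\<phi> h x = x" if "h \<in> generate G (\<Union>i\<in>{1..m}. A i)" for h
    using fixed_by_generate[OF assms(1,7) _ x(1) _ that] assms(2) x(2) by blast
  then show ?thesis
    using x(1) assms(3) by (auto simp: has_fixed_point_def)
qed

end
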